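(* Let $(\mathbb{X},\oplus,\otimes,\mathbb{0},\mathbb{1})$ be a linearly ordered, radicable idempotent semifield, and let $\bm{A},\bm{B}\in\mathbb{X}^{n\times n}$. Consider the bi-objective problem of finding regular vectors $\bm{x}\in\mathbb{X}^{n}$ that $$\text{minimize}\quad(\bm{x}^{-}\bm{A}\bm{x},\ \bm{x}^{-}\bm{B}\bm{x}).\qquad(\mathrm{P})$$ Let $\mu$ be the spectral radius of $\bm{A}$ and $\nu$ the spectral radius of $\bm{B}$, that is, $$\mu=\bigoplus_{k=1}^{n}\mathrm{tr}^{1/k}(\bm{A}^{k}),\qquad \nu=\bigoplus_{k=1}^{n}\mathrm{tr}^{1/k}(\bm{B}^{k}),$$ and suppose that $\mu>\mathbb{0}$ and $\nu>\mathbb{0}$. For $s,t>\mathbb{0}$ define $$G(s)=\bigoplus_{k=1}^{n-1}\bigoplus_{m=1}^{n-k}\bigoplus_{i_{1}+\cdots+i_{k}=m}s^{-k/m}\,\mathrm{tr}^{1/m}(\bm{B}\bm{A}^{i_{1}}\cdots\bm{B}\bm{A}^{i_{k}}),$$ $$H(t)=\bigoplus_{k=1}^{n-1}\bigoplus_{m=1}^{n-k}\bigoplus_{i_{1}+\cdots+i_{k}=m}t^{-m/k}\,\mathrm{tr}^{1/k}(\bm{B}\bm{A}^{i_{1}}\cdots\bm{B}\bm{A}^{i_{k}}),$$ where the innermost sums are over all nonnegative integers $i_{1},\ldots,i_{k}$ with $i_{1}+\cdots+i_{k}=m$. Then the following statements hold: 1. If $\mu<G(\nu)$, then the Pareto frontier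 of problem (P) is the set of points $(\alpha,\beta)$ defined by the conditions $$\mu\leq\alpha\leq G(\nu),\qquad \beta=H(\alpha),$$ and all regular Pareto-optimal solutions (those corresponding to the frontier point $(\alpha,\beta)$, for each such point) are given by $$\bm{x}=(\alpha^{-1}\bm{A}\oplus\beta^{-1}\bm{B})^{\ast}\bm{u},\qquad \bm{u}>\bm{0}.$$ 2. If $\mu\geq G(\nu)$, then the Pareto frontier is reduced to the single point $$\alpha=\mu,\qquad\beta=\nu,$$ and all regular (Pareto-optimal) solutions are given by $$\bm{x}=(\mu^{-1}\bm{A}\oplus\nu^{-1}\bm{B})^{\ast}\bm{u},\qquad \bm{u}>\bm{0}.$$
   Context: **Semifield.** $(\mathbb{X},\oplus,\otimes,\mathbb{0},\mathbb{1})$ is a set with two associative and commutative operations such that: $\oplus$ is idempotent ($x\oplus x=x$) with neutral element $\mathbb{0}$; $\otimes$ distributes over $\oplus$, has identity $\mathbb{1}$, and every $x\neq\mathbb{0}$ has a multiplicative inverse $x^{-1}$ (the nonzero elements form an abelian group; $\mathbb{0}\otimes x=\mathbb{0}$). The sign $\otimes$ is omitted. The order is defined by $x\leq y$ iff $x\oplus y=y$, and it is assumed to be total. Integer powers denote iterated products ($x^{0}=\mathbb{1}$, $x^{-p}=(x^{-1})^{p}$ for $x\neq\mathbb{0}$). It is assumed that $x^{p}=a$ is solvable in $x$ for every $a\in\mathbb{X}$ and integer $p\geq1$, which defines rational powers (with $\mathbb{0}^{q}=\mathbb{0}$ for rational $q>0$). Example: $\mathbb{R}_{\max,\times}=(\mathbb{R}_{+},\max,\times,0,1)$.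 **Matrices and vectors.** Matrix addition, matrix multiplication and scalar multiplication over $\mathbb{X}$ follow the usual entrywise formulas with $\oplus,\otimes$ in place of $+,\times$. Inequalities between matrices or vectors are entrywise. $\bm{I}$ is the identity matrix ($\mathbb{1}$ on the diagonal, $\mathbb{0}$ elsewhere), $\bm{A}^{0}=\bm{I}$, $\bm{A}^{p}=\bm{A}\bm{A}^{p-1}$. The trace is $\mathrm{tr}\,\bm{A}=a_{11}\oplus\cdots\oplus a_{nn}$, and $\mathrm{tr}^{1/k}(\bm{M})$ means $(\mathrm{tr}\,\bm{M})^{1/k}$. An empty sum $\bigoplus$ equals $\mathbb{0}$. $\mathbb{X}^{n}$ is the set of column vectors with $n$ entries. A vector is regular if it has no entry equal to $\mathbb{0}$; $\bm{u}>\bm{0}$ means that $\bm{u}\in\mathbb{X}^{n}$ is an arbitrary regular vector. For a regular column vector $\bm{x}=(x_{i})$, $\bm{x}^{-}$ is the row vector with entries $x_{i}^{-1}$. **Kleene star.** For $\bm{M}\in\mathbb{X}^{n\times n}$ with $\mathrm{Tr}(\bm{M})=\bigoplus_{k=1}^{n}\mathrm{tr}\,\bm{M}^{k}\leq\mathbb{1}$, $\bm{M}^{\ast}=\bm{I}\oplus\bm{M}\oplus\cdots\oplus\bm{M}^{n-1}$. **Pareto optimality.** A regular vector $\bm{x}$ is a Pareto-optimal (nondominated) solution of (P) if there is no regular vector $\bm{y}$ with $\bm{y}^{-}\bm{A}\bm{y}\leq\bm{x}^{-}\bm{A}\bm{x}$ and $\bm{y}^{-}\bm{B}\bm{y}\leq\bm{x}^{-}\bm{B}\bm{x}$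 with at least one of these inequalities strict. The Pareto frontier is the set of points $(\alpha,\beta)=(\bm{x}^{-}\bm{A}\bm{x},\bm{x}^{-}\bm{B}\bm{x})$ over all Pareto-optimal $\bm{x}$; a solution $\bm{x}$ corresponds to the frontier point $(\alpha,\beta)$ if $\bm{x}^{-}\bm{A}\bm{x}=\alpha$ and $\bm{x}^{-}\bm{B}\bm{x}=\beta$. *)

theory Defs
  imports "HOL-Analysis.Analysis"
begin

text \<open>
  Idempotent semifields are written additively and multiplicatively: \<open>+\<close>, \<open>*\<close>, \<open>0\<close>, \<open>1\<close> stand
  for the idempotent addition, the multiplication and their neutral elements, and big sums are
  iterated idempotent additions (an empty sum is \<open>0\<close>).  The value of \<open>inverse 0\<close> is left open.
\<close>

class idempotent_semifield = comm_semiring_1 + inverse +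
  assumes add_idem: "x + x = x"
    and right_inverse_nonzero: "x \<noteq> 0 \<Longrightarrow> x * inverse x = 1"
    and divide_eq_times_inverse: "x / y = x * inverse y"

class linordered_idempotent_semifield = idempotent_semifield + linorder +
  assumes le_iff_add_eq: "x \<le> y \<longleftrightarrow> x + y = y"

class radicable_linordered_idempotent_semifield = linordered_idempotent_semifield +
  assumes ex_root: "p \<ge> 1 \<Longrightarrow> \<exists>x. x ^ p = a"

definition semifield_root :: "nat \<Rightarrow> 'a::radicable_linordered_idempotent_semifield \<Rightarrow> 'a"
  where "semifield_root p a = (THE x. x ^ p = a)"

lemma idem_zero_le: "0 \<le> (x::'a::linordered_idempotent_semifield)"
  by (simp add: le_iff_add_eq)

lemma idem_mult_left_mono:
  fixes x y z :: "'a::linordered_idempotent_semifield"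
  assumes "x \<le> y"
  shows "z * x \<le> z * y"
  using assms by (simp add: le_iff_add_eq flip: distrib_left)

lemma idem_mult_strict_left_mono:
  fixes x y z :: "'a::linordered_idempotent_semifield"
  assumes "x < y" "z \<noteq> 0"
  shows "z * x < z * y"
proof -
  have "z * x \<noteq> z * y"
  proof
    assume "z * x = z * y"
    then have "(z * inverse z) * x = (z * inverse z) * y"
      by (metis mult.assoc mult.commute)
    with assms show False by (simp add: right_inverse_nonzero)
  qed
  moreover have "z * x \<le> z * y" using assms by (intro idem_mult_left_mono) simp
  ultimately show ?thesis by simp
qed

lemma idem_power_strict_mono:
  fixes x y :: "'a::linordered_idempotent_semifield"
  assumes "x < y" "p \<ge> 1"
  shows "x ^ p < y ^ p"
  using \<open>p \<ge> 1\<close>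
proof (induction p rule: dec_induct)
  case base
  show ?case using assms by simp
next
  case (step p)
  have "y \<noteq> 0" using assms(1) idem_zero_le[of x] by auto
  have "x ^ Suc p \<le> x * y ^ p"
    using step.IH by (simp add: idem_mult_left_mono)
  also have "x * y ^ p = y ^ p * x" by (simp add: mult.commute)
  also have "y ^ p * x < y ^ p * y"
  proof (rule idem_mult_strict_left_mono[OF assms(1)])
    show "y ^ p \<noteq> 0" using step.IH idem_zero_le[of "x ^ p"] by auto
  qed
  finally show ?case by (simp add: mult.commute)
qed

lemma semifield_root_unique:
  fixes a :: "'a::radicable_linordered_idempotent_semifield"
  assumes "p \<ge> 1"
  shows "\<exists>!x. x ^ p = a"
proof (rule ex_ex1I)
  show "\<exists>x. x ^ p = a" using assms by (rule ex_root)
  show "x = y" if "x ^ p = a" "y ^ p = a" for x y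
    using that assms idem_power_strict_mono[of x y p] idem_power_strict_mono[of y x p]
    by (cases x y rule: linorder_cases) auto
qed

text \<open>
  For \<open>q = a / b\<close> in lowest terms with \<open>b > 0\<close>, \<open>x\<close> to the power \<open>q\<close> is the integer power
  \<open>a\<close> of the \<open>b\<close>-th root of \<open>x\<close>.  Only powers of nonzero elements and positive powers of \<open>0\<close>
  are meaningful.
\<close>

definition rat_power :: "'a::radicable_linordered_idempotent_semifield \<Rightarrow> rat \<Rightarrow> 'a"
  where "rat_power x q = (case quotient_of q of (a, b) \<Rightarrow> semifield_root (nat b) x powi a)"

definition matrix_scale :: "'a::times \<Rightarrow> 'a^'n^'m \<Rightarrow> 'a^'n^'m"  (infixl \<open>*k\<close> 70)
  where "c *k M = (\<chi> i j. c * M $ i $ j)"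

text \<open>The instance of \<open>^\<close> for \<^typ>\<open>'a^'n^'n\<close> is entrywise, hence a separate matrix power.\<close>

primrec matrix_pow :: "'a::comm_semiring_1^'n^'n \<Rightarrow> nat \<Rightarrow> 'a^'n^'n" where
  "matrix_pow M 0 = mat 1"
| "matrix_pow M (Suc p) = M ** matrix_pow M p"

definition regular :: "'a::zero^'n \<Rightarrow> bool"
  where "regular x \<longleftrightarrow> (\<forall>i. x $ i \<noteq> 0)"

definition conj_vec :: "'a::inverse^'n \<Rightarrow> 'a^'n"
  where "conj_vec x = (\<chi> i. inverse (x $ i))"

definition conj_form :: "'a::idempotent_semifield^'n^'n \<Rightarrow> 'a^'n \<Rightarrow> 'a"
  where "conj_form M x = (\<Sum>i\<in>UNIV. conj_vec x $ i * (M *v x) $ i)"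

definition spectral_radius ::
    "'a::radicable_linordered_idempotent_semifield^'n^'n \<Rightarrow> 'a"
  where "spectral_radius M =
    (\<Sum>k = 1..CARD('n). rat_power (trace (matrix_pow M k)) (1 / of_nat k))"

definition Tr :: "'a::comm_semiring_1^'n^'n \<Rightarrow> 'a"
  where "Tr M = (\<Sum>k = 1..CARD('n). trace (matrix_pow M k))"

text \<open>The star is only used for matrices with \<^term>\<open>Tr M \<le> 1\<close>.\<close>

definition kleene_star :: "'a::comm_semiring_1^'n^'n \<Rightarrow> 'a^'n^'n"
  where "kleene_star M = (\<Sum>k = 0..CARD('n) - 1. matrix_pow M k)"

definition pareto_optimal ::
    "'a::linordered_idempotent_semifield^'n^'n \<Rightarrow> 'a^'n^'n \<Rightarrow> 'a^'n \<Rightarrow> bool"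
  where "pareto_optimal A B x \<longleftrightarrow> regular x \<and>
    \<not> (\<exists>y. regular y \<and> conj_form A y \<le> conj_form A x \<and> conj_form B y \<le> conj_form B x \<and>
          (conj_form A y < conj_form A x \<or> conj_form B y < conj_form B x))"

definition pareto_frontier ::
    "'a::linordered_idempotent_semifield^'n^'n \<Rightarrow> 'a^'n^'n \<Rightarrow> ('a \<times> 'a) set"
  where "pareto_frontier A B = {(conj_form A x, conj_form B x) | x. pareto_optimal A B x}"

text \<open>The tuples \<open>(i\<^sub>1, \<dots>, i\<^sub>k)\<close> of nonnegative integers with sum \<open>m\<close>, as lists.\<close>

definition weak_compositions :: "nat \<Rightarrow> nat \<Rightarrow> nat list set"
  where "weak_compositions k m = {is. length is = k \<and> sum_list is = m}"

lemma finite_weak_compositions: "finite (weak_compositions k m)"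
proof (rule finite_subset)
  show "weak_compositions k m \<subseteq> {is. set is \<subseteq> {..m} \<and> length is = k}"
    by (auto simp: weak_compositions_def intro: member_le_sum_list)
  show "finite {is. set is \<subseteq> {..m} \<and> length is = k}"
    by (rule finite_lists_length_eq) simp
qed

primrec BA_word ::
    "'a::comm_semiring_1^'n^'n \<Rightarrow> 'a^'n^'n \<Rightarrow> nat list \<Rightarrow> 'a^'n^'n" where
  "BA_word A B [] = mat 1"
| "BA_word A B (i # is) = B ** matrix_pow A i ** BA_word A B is"

definition G ::
    "'a::radicable_linordered_idempotent_semifield^'n^'n \<Rightarrow> 'a^'n^'n \<Rightarrow> 'a \<Rightarrow> 'a"
  where "G A B s =
    (\<Sum>k = 1..CARD('n) - 1. \<Sum>m = 1..CARD('n) - k. \<Sum>is\<in>weak_compositions k m.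
      rat_power s (- (of_nat k / of_nat m)) * rat_power (trace (BA_word A B is)) (1 / of_nat m))"

definition H ::
    "'a::radicable_linordered_idempotent_semifield^'n^'n \<Rightarrow> 'a^'n^'n \<Rightarrow> 'a \<Rightarrow> 'a"
  where "H A B t =
    (\<Sum>k = 1..CARD('n) - 1. \<Sum>m = 1..CARD('n) - k. \<Sum>is\<in>weak_compositions k m.
      rat_power t (- (of_nat m / of_nat k)) * rat_power (trace (BA_word A B is)) (1 / of_nat k))"

end

theory Submission
  imports Defs
begin

text \<open>
  Pareto optimality depends on a vector only through its pair of objective values, so the problem
  reduces to describing the pairs \<open>(\<alpha>, \<beta>)\<close> for which some regular \<open>x\<close> has \<open>x\<^sup>-Ax \<le> \<alpha>\<close> and
  \<open>x\<^sup>-Bx \<le> \<beta>\<close> (\<open>feasible\<close>): the frontier consists of the minimal feasible pairs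
  (\<open>pareto_frontier_eq_minimal_feasible\<close>).  For nonzero bounds the two inequalities say
  \<open>Ax \<le> \<alpha>x\<close> and \<open>Bx \<le> \<beta>x\<close>, which together are the single inequality \<open>Cx \<le> x\<close> with
  \<open>C = \<alpha>\<^sup>-\<^sup>1A + \<beta>\<^sup>-\<^sup>1B\<close>.

  If \<open>Tr C \<le> 1\<close>, the regular solutions of \<open>Cx \<le> x\<close> are exactly the vectors \<open>C\<^sup>*u\<close> with \<open>u\<close> regular
  (\<open>regular_subsolutions_eq_kleene_star_image\<close>): a walk with as many steps as there are indices
  repeats a vertex, and removing the closed part in between cannot decrease its weight, so
  \<open>C C\<^sup>* \<le> C\<^sup>*\<close>.

  The traces of the powers of \<open>C\<close> expand into traces of words in \<open>A\<close> and \<open>B\<close>.  A trace is invariant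
  under cyclic rotation, so each word counts as a power of \<open>A\<close>, a power of \<open>B\<close>, or a mixed word
  \<open>B A\<^bsup>i\<^esup> \<dots> B A\<^bsup>j\<^esup>\<close>.  Hence \<open>Tr C \<le> 1\<close> amounts to \<open>\<mu> \<le> \<alpha>\<close>, \<open>\<nu> \<le> \<beta>\<close> and a family of inequalities
  \<open>tr W \<le> \<beta>\<^sup>k \<alpha>\<^sup>m\<close> over mixed words \<open>W\<close>.  Solving this family for \<open>\<alpha>\<close> gives \<open>G \<beta> \<le> \<alpha>\<close>, solving it
  for \<open>\<beta>\<close> gives \<open>H \<alpha> \<le> \<beta>\<close> (\<open>G_le_iff\<close>, \<open>H_le_iff\<close>), and a regular vector that satisfies the
  bounds forces all these inequalities directly (\<open>feasible_imp_bounds\<close>).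

  What remains is to find the minimal points of
  \<open>{(\<alpha>, \<beta>). \<mu> \<le> \<alpha> \<and> \<nu> \<le> \<beta> \<and> H \<alpha> \<le> \<beta>}\<close>.  If \<open>G \<nu> \<le> \<mu>\<close>, the corner \<open>(\<mu>, \<nu>)\<close> lies in this set and is
  its least point.  Otherwise the curve \<open>\<beta> = H \<alpha>\<close> cuts the corner off; it meets the line \<open>\<beta> = \<nu>\<close> at
  \<open>\<alpha> = G \<nu>\<close> (\<open>H_of_G\<close>) and is strictly decreasing (\<open>H_strict_antimono\<close>), so its arc over
  \<open>[\<mu>, G \<nu>]\<close> is the set of minimal points.
\<close>

section \<open>Order and roots\<close>

context linordered_idempotent_semifield
begin

subclass canonically_ordered_monoid_add
proof
  fix a b
  show "a \<le> b \<longleftrightarrow> (\<exists>c. b = a + c)"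
    by (metis le_iff_add_eq add.assoc add_idem)
qed

subclass ordered_comm_semiring
proof
  fix a b c
  show "a \<le> b \<Longrightarrow> 0 \<le> c \<Longrightarrow> c * a \<le> c * b"
    by (metis le_iff_add_eq distrib_left)
qed

subclass semiring_1_no_zero_divisors
proof
  fix a b
  show "a \<noteq> 0 \<Longrightarrow> b \<noteq> 0 \<Longrightarrow> a * b \<noteq> 0"
    by (metis mult.assoc mult.commute mult_1_left mult_zero_right right_inverse_nonzero)
qed

end

lemma add_le_iff:
  fixes x y z :: "'a::linordered_idempotent_semifield"
  shows "x + y \<le> z \<longleftrightarrow> x \<le> z \<and> y \<le> z"
proof
  assume "x \<le> z \<and> y \<le> z"
  then show "x + y \<le> z"
    using add_mono[of x z y z] by (simp add: add_idem)
next
  assume "x + y \<le> z"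
  then show "x \<le> z \<and> y \<le> z"
    by (metis le_iff_add add.commute order_trans)
qed

lemma sum_le_iff:
  fixes f :: "'b \<Rightarrow> 'a::linordered_idempotent_semifield"
  assumes "finite S"
  shows "sum f S \<le> z \<longleftrightarrow> (\<forall>i\<in>S. f i \<le> z)"
  using assms by (induction S) (auto simp: add_le_iff)

text \<open>
  Idempotent addition is the maximum of a total order, so a sum is one of its terms.  The sum must
  be nonzero because empty and infinite sums are \<open>0\<close>.
\<close>

lemma nonzero_sum_attained:
  fixes f :: "'b \<Rightarrow> 'a::linordered_idempotent_semifield"
  assumes "sum f S = z" "z \<noteq> 0"
  shows "\<exists>i\<in>S. f i = z"
  using assms
proof (induction S arbitrary: z rule: infinite_finite_induct)
  case (insert i S)
  consider "f i \<le> sum f S" | "sum f S \<le> f i"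
    by (rule linorder_le_cases)
  then show ?case
  proof cases
    case 1
    then have "f i + sum f S = sum f S"
      by (simp add: le_iff_add_eq)
    with insert show ?thesis by auto
  next
    case 2
    then have "f i + sum f S = f i"
      by (simp add: le_iff_add_eq add.commute)
    with insert show ?thesis by auto
  qed
qed auto

lemma mult_le_cancel_left_nonzero:
  fixes x y z :: "'a::linordered_idempotent_semifield"
  assumes "z \<noteq> 0"
  shows "z * x \<le> z * y \<longleftrightarrow> x \<le> y"
  using assms idem_mult_left_mono idem_mult_strict_left_mono by (metis not_le)

lemma inverse_mult_le_iff:
  fixes x y z :: "'a::linordered_idempotent_semifield"
  assumes "z \<noteq> 0"
  shows "inverse z * x \<le> y \<longleftrightarrow> x \<le> z * y"
  using mult_le_cancel_left_nonzero[OF assms, of "inverse z * x" y] right_inverse_nonzero[OF assms]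
  by (simp flip: mult.assoc)

lemma inverse_power_mult_le_iff:
  fixes x y z :: "'a::linordered_idempotent_semifield"
  assumes "z \<noteq> 0"
  shows "inverse z ^ p * x \<le> y \<longleftrightarrow> x \<le> z ^ p * y"
proof -
  have "z ^ p * inverse z ^ p = 1"
    using right_inverse_nonzero[OF assms] by (simp flip: power_mult_distrib)
  then have "z ^ p * (inverse z ^ p * x) = x"
    by (simp flip: mult.assoc)
  then show ?thesis
    using mult_le_cancel_left_nonzero[of "z ^ p" "inverse z ^ p * x" y] assms by simp
qed

lemma power_le_power_iff:
  fixes x y :: "'a::linordered_idempotent_semifield"
  assumes "p \<ge> 1"
  shows "x ^ p \<le> y ^ p \<longleftrightarrow> x \<le> y"
  using assms idem_power_strict_mono[of x y p] idem_power_strict_mono[of y x p]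
  by (metis leD leI order.order_iff_strict)

lemma semifield_root_power:
  assumes "p \<ge> 1"
  shows "semifield_root p a ^ p = a"
  unfolding semifield_root_def by (rule theI'[OF semifield_root_unique[OF assms]])

lemma rat_power_unit_fraction:
  assumes "k \<ge> 1"
  shows "rat_power t (1 / of_nat k) ^ k = t"
proof -
  have "1 / of_nat k = Fract 1 (int k)"
    using assms by (simp add: Fract_of_int_quotient)
  then have "quotient_of (1 / of_nat k) = (1, int k)"
    using assms by (simp add: quotient_of_Fract normalize_def)
  then show ?thesis
    using assms by (simp add: rat_power_def semifield_root_power)
qed

lemma rat_power_neg_fraction:
  assumes "d \<ge> 1" "s \<noteq> 0"
  shows "rat_power s (- (of_nat c / of_nat d)) ^ d = inverse s ^ c"
proof -
  define q :: rat where "q = - (of_nat c / of_nat d)"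
  obtain a b where ab: "quotient_of q = (a, b)"
    by (cases "quotient_of q")
  have b: "b > 0" and q: "q = of_int a / of_int b"
    using quotient_of_denom_pos[OF ab] quotient_of_div[OF ab] by auto
  \<comment> \<open>The denominator \<open>b\<close> in lowest terms may differ from \<open>d\<close>; cross-multiplying avoids common factors.\<close>
  have "of_int (a * int d) = (of_int (- int c * b) :: rat)"
    using assms b q unfolding q_def by (simp add: field_simps)
  then have eq: "a * int d = - int c * b"
    by (simp only: of_int_eq_iff)
  define r where "r = semifield_root (nat b) s"
  have r: "r ^ nat b = s"
    unfolding r_def using b by (intro semifield_root_power) linarith
  with assms b have "r \<noteq> 0" by (auto simp: zero_power)
  have "a \<le> 0"
  proof (rule ccontr)
    assume "\<not> a \<le> 0"
    then have "0 < a * int d" using assms by simp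
    moreover have "0 \<le> int c * b" using b by simp
    ultimately show False using eq by linarith
  qed
  then have "r powi a = inverse r ^ nat (- a)"
    by (cases "a = 0") (auto simp: power_int_def)
  moreover have "nat (- a) * d = nat b * c"
  proof -
    have "int (nat (- a) * d) = int (nat b * c)"
      using \<open>a \<le> 0\<close> b eq by (simp add: mult.commute)
    then show ?thesis by (simp only: of_nat_eq_iff)
  qed
  ultimately have "(r powi a) ^ d = (inverse r ^ nat b) ^ c"
    by (simp flip: power_mult)
  moreover have "inverse r ^ nat b = inverse s"
  proof -
    have "s * inverse r ^ nat b = 1"
      using right_inverse_nonzero[OF \<open>r \<noteq> 0\<close>] by (simp flip: r power_mult_distrib)
    then show ?thesis
      by (metis assms(2) mult.assoc mult.commute mult_1_left right_inverse_nonzero)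
  qed
  ultimately show ?thesis
    by (simp add: rat_power_def ab r_def flip: q_def)
qed

lemma rat_power_unit_fraction_le_iff:
  assumes "k \<ge> 1"
  shows "rat_power t (1 / of_nat k) \<le> z \<longleftrightarrow> t \<le> z ^ k"
  using power_le_power_iff[OF assms, of "rat_power t (1 / of_nat k)" z]
  by (simp add: rat_power_unit_fraction[OF assms])

text \<open>
  Clears the fractional exponents in one term of \<open>G\<close> or \<open>H\<close>.  The resulting inequality treats the
  variable \<open>s\<close> and the bound \<open>z\<close> alike, which is why \<open>G\<close> and \<open>H\<close> encode the same constraints.
\<close>

lemma frontier_term_le_iff:
  assumes "d \<ge> 1" "s \<noteq> 0"
  shows "rat_power s (- (of_nat c / of_nat d)) * rat_power t (1 / of_nat d) \<le> z
    \<longleftrightarrow> t \<le> s ^ c * z ^ d"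
  using power_le_power_iff[OF assms(1), of "rat_power s (- (of_nat c / of_nat d)) * rat_power t (1 / of_nat d)" z]
  by (simp add: rat_power_unit_fraction[OF assms(1)] rat_power_neg_fraction[OF assms]
      power_mult_distrib inverse_power_mult_le_iff[OF assms(2)])

lemma frontier_term_eqD:
  assumes "rat_power s (- (of_nat c / of_nat d)) * rat_power t (1 / of_nat d) = z"
    and "d \<ge> 1" "s \<noteq> 0"
  shows "t = s ^ c * z ^ d"
proof -
  have "z ^ d = inverse s ^ c * t"
    unfolding assms(1)[symmetric]
    by (simp only: power_mult_distrib rat_power_unit_fraction[OF assms(2)]
        rat_power_neg_fraction[OF assms(2,3)])
  then have "s ^ c * z ^ d = (s * inverse s) ^ c * t"
    by (simp add: power_mult_distrib mult.assoc)
  then show ?thesis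
    by (simp add: right_inverse_nonzero assms)
qed

section \<open>Subeigenvectors\<close>

lemma matrix_vector_le_iff:
  fixes M :: "'a::linordered_idempotent_semifield^'n^'m"
  shows "M *v x \<le> y \<longleftrightarrow> (\<forall>i j. M $ i $ j * x $ j \<le> y $ i)"
  by (auto simp: less_eq_vec_def matrix_vector_mult_def sum_le_iff)

lemma conj_form_le_iff:
  fixes M :: "'a::linordered_idempotent_semifield^'n^'n"
  assumes "regular x"
  shows "conj_form M x \<le> a \<longleftrightarrow> M *v x \<le> a *s x"
  using assms
  by (auto simp: conj_form_def conj_vec_def sum_le_iff less_eq_vec_def regular_def
      inverse_mult_le_iff mult.commute)

text \<open>
  Subeigenvalues multiply along matrix products, so bounds for \<open>A\<close> and \<open>B\<close> at one vector propagate
  to every word in \<open>A\<close> and \<open>B\<close>.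
\<close>

lemma matrix_mult_subeigen:
  fixes M N :: "'a::linordered_idempotent_semifield^'n^'n"
  assumes "M *v x \<le> a *s x" "N *v x \<le> b *s x"
  shows "(M ** N) *v x \<le> (a * b) *s x"
proof -
  have "(M ** N) *v x = M *v (N *v x)"
    by (simp add: matrix_vector_mul_assoc)
  also have "\<dots> \<le> (a * b) *s x"
    unfolding matrix_vector_le_iff
  proof (intro allI)
    fix i j
    have "M $ i $ j * (N *v x) $ j \<le> M $ i $ j * (b * x $ j)"
      using assms(2) by (intro idem_mult_left_mono) (simp add: less_eq_vec_def)
    also have "\<dots> = b * (M $ i $ j * x $ j)"
      by (simp add: ac_simps)
    also have "\<dots> \<le> b * (a * x $ i)"
      using assms(1) by (intro idem_mult_left_mono) (simp add: matrix_vector_le_iff)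
    finally show "M $ i $ j * (N *v x) $ j \<le> ((a * b) *s x) $ i"
      by (simp add: ac_simps)
  qed
  finally show ?thesis .
qed

lemma matrix_pow_subeigen:
  fixes M :: "'a::linordered_idempotent_semifield^'n^'n"
  assumes "M *v x \<le> a *s x"
  shows "matrix_pow M k *v x \<le> (a ^ k) *s x"
proof (induction k)
  case (Suc k)
  then show ?case using matrix_mult_subeigen[OF assms] by simp
qed simp

lemma BA_word_subeigen:
  fixes A B :: "'a::linordered_idempotent_semifield^'n^'n"
  assumes "A *v x \<le> a *s x" "B *v x \<le> b *s x"
  shows "BA_word A B is *v x \<le> (b ^ length is * a ^ sum_list is) *s x"
proof (induction "is")
  case Nil
  then show ?case by (simp add: less_eq_vec_def)
next
  case (Cons i "is")
  have "b * a ^ i * (b ^ length is * a ^ sum_list is)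
      = b ^ length (i # is) * a ^ sum_list (i # is)"
    by (simp add: power_add ac_simps)
  then show ?case
    using matrix_mult_subeigen[OF matrix_mult_subeigen[OF assms(2) matrix_pow_subeigen[OF assms(1), of i]] Cons]
    by simp
qed

text \<open>
  The diagonal part of row \<open>i\<close> gives \<open>M\<^sub>i\<^sub>i x\<^sub>i \<le> a x\<^sub>i\<close>, and the nonzero \<open>x\<^sub>i\<close> cancels.
\<close>

lemma trace_le_if_subeigen:
  fixes M :: "'a::linordered_idempotent_semifield^'n^'n"
  assumes "M *v x \<le> a *s x" "regular x"
  shows "trace M \<le> a"
  unfolding trace_def sum_le_iff[OF finite]
proof
  fix i
  have "x $ i * M $ i $ i \<le> x $ i * a"
    using assms(1) by (simp add: matrix_vector_le_iff mult.commute)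
  then show "M $ i $ i \<le> a"
    using assms(2) by (simp add: regular_def mult_le_cancel_left_nonzero)
qed

section \<open>Kleene star\<close>

text \<open>
  The entries of \<open>M\<^sup>p\<close> are the maximal weights of walks with \<open>p\<close> steps; this and
  \<open>matrix_pow_attained_by_walk\<close> are the two halves of this fact.  The offset \<open>s\<close> allows walks to be
  cut into consecutive pieces.
\<close>

lemma walk_weight_le_matrix_pow:
  fixes M :: "'a::linordered_idempotent_semifield^'n^'n"
  shows "(\<Prod>k<p. M $ f (s + k) $ f (Suc (s + k))) \<le> matrix_pow M p $ f s $ f (s + p)"
proof (induction p arbitrary: s)
  case 0
  then show ?case by (simp add: mat_def)
next
  case (Suc p)
  have "(\<Prod>k<Suc p. M $ f (s + k) $ f (Suc (s + k)))
      = M $ f s $ f (Suc s) * (\<Prod>k<p. M $ f (Suc s + k) $ f (Suc (Suc s + k)))"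
    by (simp only: prod.lessThan_Suc_shift add_Suc_right add_Suc add_0_right)
  also have "\<dots> \<le> M $ f s $ f (Suc s) * matrix_pow M p $ f (Suc s) $ f (Suc s + p)"
    by (intro idem_mult_left_mono Suc.IH)
  also have "\<dots> \<le> matrix_pow M (Suc p) $ f s $ f (s + Suc p)"
    by (auto simp: matrix_matrix_mult_def intro!: member_le_sum)
  finally show ?case .
qed

lemma matrix_pow_attained_by_walk:
  fixes M :: "'a::linordered_idempotent_semifield^'n^'n"
  assumes "matrix_pow M p $ i $ j \<noteq> 0"
  shows "\<exists>f. f 0 = i \<and> f p = j \<and> matrix_pow M p $ i $ j = (\<Prod>k<p. M $ f k $ f (Suc k))"
  using assms
proof (induction p arbitrary: i)
  case 0
  then have "i = j" by (auto simp: mat_def split: if_splits)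
  then show ?case by (intro exI[of _ "\<lambda>_. i"]) (simp add: mat_def)
next
  case (Suc p)
  have sum: "matrix_pow M (Suc p) $ i $ j = (\<Sum>l\<in>UNIV. M $ i $ l * matrix_pow M p $ l $ j)"
    by (simp add: matrix_matrix_mult_def)
  obtain l where l: "M $ i $ l * matrix_pow M p $ l $ j = matrix_pow M (Suc p) $ i $ j"
    using nonzero_sum_attained[OF sum[symmetric] Suc.prems] by blast
  with Suc.prems have "matrix_pow M p $ l $ j \<noteq> 0" by auto
  with Suc.IH obtain f where "f 0 = l" "f p = j"
    "matrix_pow M p $ l $ j = (\<Prod>k<p. M $ f k $ f (Suc k))" by blast
  with l show ?case
    by (intro exI[of _ "case_nat i f"]) (simp add: prod.lessThan_Suc_shift del: prod.lessThan_Suc)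
qed

lemma matrix_pow_add: "matrix_pow M (p + q) = matrix_pow M p ** matrix_pow M q"
  by (induction p) (simp_all add: matrix_mul_assoc)

lemma matrix_pow_le_kleene_star:
  fixes M :: "'a::linordered_idempotent_semifield^'n^'n"
  assumes "k < CARD('n)"
  shows "matrix_pow M k $ i $ j \<le> kleene_star M $ i $ j"
  using assms by (auto simp: kleene_star_def intro!: member_le_sum)

text \<open>
  Let \<open>n\<close> be the number of indices.  A maximal walk with \<open>n\<close> steps visits \<open>n + 1\<close> vertices, so it contains a cycle.  The cycle has between
  \<open>1\<close> and \<open>n\<close> steps, hence weight at most \<open>Tr M \<le> 1\<close>; what is left after cutting it out is a walk
  with fewer than \<open>n\<close> steps.
\<close>

lemma matrix_pow_card_le_kleene_star:
  fixes M :: "'a::linordered_idempotent_semifield^'n^'n"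
  assumes "Tr M \<le> 1"
  shows "matrix_pow M CARD('n) $ i $ j \<le> kleene_star M $ i $ j"
proof (cases "matrix_pow M CARD('n) $ i $ j = 0")
  case False
  define n where "n = CARD('n)"
  obtain f where f: "f 0 = i" "f n = j"
    "matrix_pow M n $ i $ j = (\<Prod>k<n. M $ f k $ f (Suc k))"
    using matrix_pow_attained_by_walk[OF False] unfolding n_def by blast
  have "\<not> inj_on f {..n}"
    using card_inj_on_le[of f "{..n}" UNIV] by (auto simp: n_def)
  then obtain s t where st: "s < t" "t \<le> n" "f s = f t"
    unfolding inj_on_def by (metis atMost_iff linorder_neqE_nat)
  define d where "d = t - s"
  let ?w = "\<lambda>a p. \<Prod>k<p. M $ f (a + k) $ f (Suc (a + k))"
  have split: "?w a (p + q) = ?w a p * ?w (a + p) q" for a p q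
    by (induction q) (simp_all add: ac_simps)
  have "matrix_pow M n $ i $ j = ?w 0 (s + (d + (n - t)))"
    using st f(3) by (simp add: d_def)
  also have "\<dots> = ?w s d * (?w 0 s * ?w t (n - t))"
    using st by (simp only: split) (simp add: d_def ac_simps)
  also have "\<dots> \<le> 1 * (matrix_pow M s $ i $ f s * matrix_pow M (n - t) $ f s $ j)"
  proof (intro mult_mono)
    have "?w s d \<le> matrix_pow M d $ f s $ f s"
      using walk_weight_le_matrix_pow[of M f s d] st by (simp add: d_def)
    also have "\<dots> \<le> trace (matrix_pow M d)"
      unfolding trace_def by (rule member_le_sum) auto
    also have "\<dots> \<le> 1"
    proof -
      have "d \<in> {1..CARD('n)}" using st by (auto simp: d_def n_def)
      then show ?thesis using assms by (simp add: Tr_def sum_le_iff)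
    qed
    finally show "?w s d \<le> 1" .
    show "?w 0 s \<le> matrix_pow M s $ i $ f s"
      using walk_weight_le_matrix_pow[of M f 0 s] f by simp
    show "?w t (n - t) \<le> matrix_pow M (n - t) $ f s $ j"
      using walk_weight_le_matrix_pow[of M f t "n - t"] st f by simp
  qed auto
  also have "\<dots> \<le> matrix_pow M (s + (n - t)) $ i $ j"
    unfolding matrix_pow_add
    by (auto simp: matrix_matrix_mult_def intro!: member_le_sum)
  also have "\<dots> \<le> kleene_star M $ i $ j"
    using st by (intro matrix_pow_le_kleene_star) (simp add: n_def)
  finally show ?thesis by (simp add: n_def)
qed simp

text \<open>
  Multiplication by \<open>M\<close> shifts the powers in the star by one, and the only new power, the \<open>n\<close>-th, is
  absorbed by \<open>matrix_pow_card_le_kleene_star\<close>.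
\<close>

lemma matrix_mult_kleene_star_le:
  fixes M :: "'a::linordered_idempotent_semifield^'n^'n"
  assumes "Tr M \<le> 1"
  shows "(M ** kleene_star M) $ i $ j \<le> kleene_star M $ i $ j"
proof -
  have "M $ i $ l * matrix_pow M k $ l $ j \<le> kleene_star M $ i $ j" if "k \<le> CARD('n) - 1" for k l
  proof -
    have "M $ i $ l * matrix_pow M k $ l $ j \<le> matrix_pow M (Suc k) $ i $ j"
      by (auto simp: matrix_matrix_mult_def intro!: member_le_sum)
    also have "\<dots> \<le> kleene_star M $ i $ j"
    proof (cases "Suc k = CARD('n)")
      case True
      then show ?thesis using matrix_pow_card_le_kleene_star[OF assms] by metis
    next
      case False
      have "0 < CARD('n)" by simp
      with False that have "Suc k < CARD('n)" by linarith
      then show ?thesis by (rule matrix_pow_le_kleene_star)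
    qed
    finally show ?thesis .
  qed
  then show ?thesis
    by (auto simp: matrix_matrix_mult_def kleene_star_def sum_le_iff sum_distrib_left)
qed

lemma vec_le_kleene_star_mult:
  fixes M :: "'a::linordered_idempotent_semifield^'n^'n"
  shows "x \<le> kleene_star M *v x"
  unfolding less_eq_vec_def
proof
  fix i
  have "(1::'a) \<le> kleene_star M $ i $ i"
    using matrix_pow_le_kleene_star[of 0 M i i] by (simp add: mat_def)
  then have "x $ i \<le> kleene_star M $ i $ i * x $ i"
    using mult_right_mono[of 1 "kleene_star M $ i $ i" "x $ i"] by simp
  also have "\<dots> \<le> (kleene_star M *v x) $ i"
    by (auto simp: matrix_vector_mult_def intro!: member_le_sum)
  finally show "x $ i \<le> (kleene_star M *v x) $ i" .
qed

text \<open>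
  Each \<open>M\<^sup>*u\<close> is a subsolution because \<open>M M\<^sup>* \<le> M\<^sup>*\<close>, and it is regular because it dominates \<open>u\<close>.
  Conversely a subsolution \<open>x\<close> is its own parameter: \<open>M\<^sup>kx \<le> x\<close> for all \<open>k\<close>, so \<open>M\<^sup>*x = x\<close>.
\<close>

lemma regular_subsolutions_eq_kleene_star_image:
  fixes M :: "'a::linordered_idempotent_semifield^'n^'n"
  assumes "Tr M \<le> 1"
  shows "{x. regular x \<and> M *v x \<le> x} = {kleene_star M *v u | u. regular u}"
proof (intro equalityI subsetI)
  fix x
  assume "x \<in> {x. regular x \<and> M *v x \<le> x}"
  then have x: "regular x" "M *v x \<le> 1 *s x" by auto
  have "kleene_star M *v x \<le> x"
    using matrix_pow_subeigen[OF x(2)]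
    by (auto simp: matrix_vector_le_iff kleene_star_def sum_distrib_right sum_le_iff)
  then have "x = kleene_star M *v x"
    using vec_le_kleene_star_mult by (rule antisym[rotated])
  with x show "x \<in> {kleene_star M *v u | u. regular u}" by blast
next
  fix x
  assume "x \<in> {kleene_star M *v u | u. regular u}"
  then obtain u where u: "x = kleene_star M *v u" "regular u" by blast
  have "x $ i \<noteq> 0" for i
    using vec_le_kleene_star_mult[of u M] u by (metis less_eq_vec_def regular_def le_zero_eq)
  moreover have "M *v x \<le> x"
  proof -
    have "(M ** kleene_star M) $ i $ j * u $ j \<le> (kleene_star M *v u) $ i" for i j
    proof -
      have "(M ** kleene_star M) $ i $ j * u $ j \<le> kleene_star M $ i $ j * u $ j"
        by (intro mult_right_mono matrix_mult_kleene_star_le assms) simp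
      also have "\<dots> \<le> (kleene_star M *v u) $ i"
        by (auto simp: matrix_vector_mult_def intro!: member_le_sum)
      finally show ?thesis .
    qed
    then show ?thesis
      by (simp add: u matrix_vector_mul_assoc matrix_vector_le_iff)
  qed
  ultimately show "x \<in> {x. regular x \<and> M *v x \<le> x}"
    by (simp add: regular_def)
qed

section \<open>Traces of powers of a sum\<close>

primrec two_letter_word :: "'a::comm_semiring_1^'n^'n \<Rightarrow> 'a^'n^'n \<Rightarrow> bool list \<Rightarrow> 'a^'n^'n" where
  "two_letter_word P Q [] = mat 1"
| "two_letter_word P Q (w # ws) = (if w then Q else P) ** two_letter_word P Q ws"

lemma matrix_mult_add_rdistrib: "(P + Q) ** X = P ** X + Q ** (X :: 'a::semiring_1^'n^'m)"
  by (simp add: vec_eq_iff matrix_matrix_mult_def distrib_right sum.distrib)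

text \<open>
  A bound on a power of \<open>P + Q\<close> follows from bounds on the words in its expansion.  The factor \<open>X\<close>
  collects the letters already chosen, so that the induction on \<open>p\<close> stays at the level of traces.
\<close>

lemma trace_mult_sum_power_le:
  fixes P Q X :: "'a::linordered_idempotent_semifield^'n^'n"
  assumes "\<And>ws. length ws = p \<Longrightarrow> trace (X ** two_letter_word P Q ws) \<le> z"
  shows "trace (X ** matrix_pow (P + Q) p) \<le> z"
  using assms
proof (induction p arbitrary: X)
  case (Suc p)
  have "trace ((X ** P) ** matrix_pow (P + Q) p) \<le> z"
    using Suc.prems[of "False # _"] by (intro Suc.IH) (simp add: matrix_mul_assoc)
  moreover have "trace ((X ** Q) ** matrix_pow (P + Q) p) \<le> z"
    using Suc.prems[of "True # _"] by (intro Suc.IH) (simp add: matrix_mul_assoc)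
  moreover have "X ** matrix_pow (P + Q) (Suc p)
      = (X ** P) ** matrix_pow (P + Q) p + (X ** Q) ** matrix_pow (P + Q) p"
    by (simp add: matrix_mul_assoc matrix_add_ldistrib matrix_mult_add_rdistrib)
  ultimately show ?case
    by (simp only: trace_add add_le_iff)
qed simp

lemma BA_word_append: "BA_word P Q (xs @ ys) = BA_word P Q xs ** BA_word P Q ys"
  by (induction xs) (simp_all add: matrix_mul_assoc)

text \<open>
  Splitting a word before each occurrence of \<open>Q\<close> leaves an initial block of \<open>P\<close>'s.
\<close>

lemma two_letter_word_normal_form:
  "\<exists>i is. two_letter_word P Q ws = matrix_pow P i ** BA_word P Q is
     \<and> i + length is + sum_list is = length ws"
proof (induction ws)
  case Nil
  show ?case by (intro exI[of _ 0] exI[of _ "[]"]) simp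
next
  case (Cons w ws)
  then obtain i "is" where IH: "two_letter_word P Q ws = matrix_pow P i ** BA_word P Q is"
    "i + length is + sum_list is = length ws" by blast
  show ?case
  proof (cases w)
    case True
    with IH show ?thesis
      by (intro exI[of _ 0] exI[of _ "i # is"]) (simp add: matrix_mul_assoc)
  next
    case False
    with IH show ?thesis
      by (intro exI[of _ "Suc i"] exI[of _ "is"]) (simp add: matrix_mul_assoc)
  qed
qed

text \<open>
  Under the trace the initial block of \<open>P\<close>'s can be rotated to the end, where it merges with the last
  exponent.
\<close>

lemma trace_two_letter_word:
  obtains "trace (two_letter_word P Q ws) = trace (matrix_pow P (length ws))"
  | "is" where "is \<noteq> []" "length is + sum_list is = length ws"
      "trace (two_letter_word P Q ws) = trace (BA_word P Q is)"
proof -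
  obtain i "is" where w: "two_letter_word P Q ws = matrix_pow P i ** BA_word P Q is"
    "i + length is + sum_list is = length ws"
    using two_letter_word_normal_form by blast
  show thesis
  proof (cases "is" rule: rev_cases)
    case Nil
    with w show thesis by (intro that(1)) simp
  next
    case (snoc xs j)
    have "trace (two_letter_word P Q ws) = trace (BA_word P Q is ** matrix_pow P i)"
      unfolding w by (rule trace_mul_sym)
    also have "BA_word P Q is ** matrix_pow P i = BA_word P Q (xs @ [j + i])"
      by (simp add: snoc BA_word_append matrix_pow_add matrix_mul_assoc)
    finally show thesis
      using w snoc by (intro that(2)[of "xs @ [j + i]"]) simp_all
  qed
qed

lemma BA_word_all_zero:
  assumes "sum_list is = 0"
  shows "BA_word P Q is = matrix_pow Q (length is)"
  using assms by (induction "is") simp_all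

text \<open>
  Words without \<open>P\<close> appear as compositions of \<open>0\<close>; treating them as powers of \<open>Q\<close> leaves exactly the
  mixed words with both letters, those that occur in \<open>G\<close> and \<open>H\<close>.
\<close>

lemma trace_sum_power_le:
  fixes P Q :: "'a::linordered_idempotent_semifield^'n^'n"
  assumes P: "trace (matrix_pow P p) \<le> z" and Q: "trace (matrix_pow Q p) \<le> z"
    and PQ: "\<And>k m is. \<lbrakk>k \<ge> 1; m \<ge> 1; k + m = p; is \<in> weak_compositions k m\<rbrakk>
      \<Longrightarrow> trace (BA_word P Q is) \<le> z"
  shows "trace (matrix_pow (P + Q) p) \<le> z"
proof -
  have "trace (two_letter_word P Q ws) \<le> z" if "length ws = p" for ws
  proof (cases rule: trace_two_letter_word[of P Q ws])
    case 1
    with P that show ?thesis by simp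
  next
    case (2 "is")
    show ?thesis
    proof (cases "sum_list is = 0")
      case True
      with 2 Q that show ?thesis by (simp add: BA_word_all_zero)
    next
      case False
      with 2 that show ?thesis
        by (subst 2(3), intro PQ[of "length is" "sum_list is"])
          (simp_all add: weak_compositions_def Suc_le_eq del: sum_list_eq_0_iff)
    qed
  qed
  then show ?thesis
    using trace_mult_sum_power_le[of p "mat 1" P Q z] by simp
qed

lemma trace_matrix_scale: "trace (c *k M) = c * trace (M :: 'a::comm_semiring_1^'n^'n)"
  by (simp add: trace_def matrix_scale_def sum_distrib_left)

lemma matrix_scale_mult_scale:
  "(c *k M) ** (d *k N) = (c * d) *k (M ** (N :: 'a::comm_semiring_1^'n^'n))"
  by (simp add: vec_eq_iff matrix_matrix_mult_def matrix_scale_def sum_distrib_left ac_simps)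

lemma mat_1_eq_scale: "mat 1 = 1 *k (mat 1 :: 'a::comm_semiring_1^'n^'n)"
  by (simp add: vec_eq_iff matrix_scale_def)

lemma matrix_pow_scale:
  "matrix_pow (c *k M) p = c ^ p *k matrix_pow (M :: 'a::comm_semiring_1^'n^'n) p"
  by (induction p) (simp_all add: matrix_scale_mult_scale flip: mat_1_eq_scale)

lemma BA_word_scale:
  fixes A B :: "'a::comm_semiring_1^'n^'n"
  shows "BA_word (a *k A) (b *k B) is = (b ^ length is * a ^ sum_list is) *k BA_word A B is"
proof (induction "is")
  case Nil
  show ?case by (simp flip: mat_1_eq_scale)
next
  case (Cons i "is")
  then show ?case
    by (simp add: matrix_scale_mult_scale matrix_pow_scale power_add ac_simps)
qed

section \<open>Feasible pairs of bounds\<close>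

definition feasible ::
    "'a::linordered_idempotent_semifield^'n^'n \<Rightarrow> 'a^'n^'n \<Rightarrow> 'a \<Rightarrow> 'a \<Rightarrow> bool"
  where "feasible A B \<alpha> \<beta> \<longleftrightarrow>
    (\<exists>x. regular x \<and> conj_form A x \<le> \<alpha> \<and> conj_form B x \<le> \<beta>)"

text \<open>
  The requirement that cycles through both matrices have weight at most \<open>1\<close> in
  \<open>\<alpha>\<^sup>-\<^sup>1A + \<beta>\<^sup>-\<^sup>1B\<close>, with denominators cleared.
\<close>

definition mixed_cycles_bounded ::
    "'a::linordered_idempotent_semifield^'n^'n \<Rightarrow> 'a^'n^'n \<Rightarrow> 'a \<Rightarrow> 'a \<Rightarrow> bool"
  where "mixed_cycles_bounded A B \<alpha> \<beta> \<longleftrightarrow>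
    (\<forall>k\<in>{1..CARD('n) - 1}. \<forall>m\<in>{1..CARD('n) - k}. \<forall>is\<in>weak_compositions k m.
      trace (BA_word A B is) \<le> \<beta> ^ k * \<alpha> ^ m)"

lemma spectral_radius_le_iff:
  fixes M :: "'a::radicable_linordered_idempotent_semifield^'n^'n"
  shows "spectral_radius M \<le> z \<longleftrightarrow> (\<forall>k\<in>{1..CARD('n)}. trace (matrix_pow M k) \<le> z ^ k)"
  by (auto simp: spectral_radius_def sum_le_iff rat_power_unit_fraction_le_iff)

lemma G_le_iff:
  assumes "\<beta> \<noteq> 0"
  shows "G A B \<beta> \<le> \<alpha> \<longleftrightarrow> mixed_cycles_bounded A B \<alpha> \<beta>"
  unfolding G_def mixed_cycles_bounded_def
  using assms by (auto simp: sum_le_iff finite_weak_compositions frontier_term_le_iff)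

lemma H_le_iff:
  assumes "\<alpha> \<noteq> 0"
  shows "H A B \<alpha> \<le> \<beta> \<longleftrightarrow> mixed_cycles_bounded A B \<alpha> \<beta>"
  unfolding H_def mixed_cycles_bounded_def
  using assms by (auto simp: sum_le_iff finite_weak_compositions frontier_term_le_iff mult.commute)

lemma nonzero_composition_sum_attained:
  fixes f :: "nat \<Rightarrow> nat \<Rightarrow> nat list \<Rightarrow> 'a::linordered_idempotent_semifield"
  assumes sum: "(\<Sum>k = 1..n - 1. \<Sum>m = 1..n - k. \<Sum>is\<in>weak_compositions k m. f k m is) = z"
    and "z \<noteq> 0"
  obtains k m "is" where "k \<in> {1..n - 1}" "m \<in> {1..n - k}" "is \<in> weak_compositions k m"
    "f k m is = z"
proof -
  obtain k where k: "k \<in> {1..n - 1}"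
    "(\<Sum>m = 1..n - k. \<Sum>is\<in>weak_compositions k m. f k m is) = z"
    using nonzero_sum_attained[OF sum \<open>z \<noteq> 0\<close>] by blast
  obtain m where m: "m \<in> {1..n - k}" "(\<Sum>is\<in>weak_compositions k m. f k m is) = z"
    using nonzero_sum_attained[OF k(2) \<open>z \<noteq> 0\<close>] by blast
  obtain "is" where "is \<in> weak_compositions k m" "f k m is = z"
    using nonzero_sum_attained[OF m(2) \<open>z \<noteq> 0\<close>] by blast
  with k m that show thesis by blast
qed

lemma G_attained:
  fixes A B :: "'a::radicable_linordered_idempotent_semifield^'n^'n"
  assumes "G A B \<beta> \<noteq> 0" "\<beta> \<noteq> 0"
  obtains k m "is" where "k \<in> {1..CARD('n) - 1}" "m \<in> {1..CARD('n) - k}"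
    "is \<in> weak_compositions k m" "trace (BA_word A B is) = \<beta> ^ k * G A B \<beta> ^ m"
proof (rule nonzero_composition_sum_attained[OF G_def[symmetric] assms(1)])
  fix k m "is"
  assume "k \<in> {1..CARD('n) - 1}" "m \<in> {1..CARD('n) - k}" "is \<in> weak_compositions k m"
    and "rat_power \<beta> (- (of_nat k / of_nat m)) * rat_power (trace (BA_word A B is)) (1 / of_nat m)
      = G A B \<beta>"
  with assms(2) show thesis
    by (intro that[of k m "is"] frontier_term_eqD) auto
qed

lemma H_attained:
  fixes A B :: "'a::radicable_linordered_idempotent_semifield^'n^'n"
  assumes "H A B \<alpha> \<noteq> 0" "\<alpha> \<noteq> 0"
  obtains k m "is" where "k \<in> {1..CARD('n) - 1}" "m \<in> {1..CARD('n) - k}"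
    "is \<in> weak_compositions k m" "trace (BA_word A B is) = \<alpha> ^ m * H A B \<alpha> ^ k"
proof (rule nonzero_composition_sum_attained[OF H_def[symmetric] assms(1)])
  fix k m "is"
  assume "k \<in> {1..CARD('n) - 1}" "m \<in> {1..CARD('n) - k}" "is \<in> weak_compositions k m"
    and "rat_power \<alpha> (- (of_nat m / of_nat k)) * rat_power (trace (BA_word A B is)) (1 / of_nat k)
      = H A B \<alpha>"
  with assms(2) show thesis
    by (intro that[of k m "is"] frontier_term_eqD) auto
qed

text \<open>
  Some mixed word makes its inequality tight at \<open>(\<alpha>, H \<alpha>)\<close>, and lowering \<open>\<alpha>\<close> alone violates that
  inequality.
\<close>

lemma H_strict_antimono:
  fixes A B :: "'a::radicable_linordered_idempotent_semifield^'n^'n"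
  assumes "\<alpha>' < \<alpha>" "\<alpha>' \<noteq> 0" "H A B \<alpha> \<noteq> 0"
  shows "H A B \<alpha> < H A B \<alpha>'"
proof -
  define h where "h = H A B \<alpha>"
  have "\<alpha> \<noteq> 0" using assms(1) by auto
  then obtain k m "is" where kmi: "k \<in> {1..CARD('n) - 1}" "m \<in> {1..CARD('n) - k}"
    "is \<in> weak_compositions k m" "trace (BA_word A B is) = \<alpha> ^ m * h ^ k"
    using H_attained[OF assms(3)] unfolding h_def by blast
  have "h ^ k * \<alpha>' ^ m < h ^ k * \<alpha> ^ m"
    using assms kmi by (intro idem_mult_strict_left_mono idem_power_strict_mono) (auto simp: h_def)
  then have "\<not> trace (BA_word A B is) \<le> h ^ k * \<alpha>' ^ m"
    by (simp add: kmi(4) mult.commute not_le)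
  then have "\<not> mixed_cycles_bounded A B \<alpha>' h"
    using kmi(1-3) unfolding mixed_cycles_bounded_def by blast
  then show ?thesis
    using H_le_iff[OF assms(2), of A B h] by (simp add: h_def not_le)
qed

text \<open>
  That \<open>H (G \<beta>) \<le> \<beta>\<close> is the Galois connection between \<open>G\<close> and \<open>H\<close>.  Equality holds because a word
  tight at \<open>(G \<beta>, \<beta>)\<close> leaves no room to lower \<open>\<beta>\<close>.
\<close>

lemma H_of_G:
  fixes A B :: "'a::radicable_linordered_idempotent_semifield^'n^'n"
  assumes "G A B \<beta> \<noteq> 0" "\<beta> \<noteq> 0"
  shows "H A B (G A B \<beta>) = \<beta>"
proof (rule antisym)
  show "H A B (G A B \<beta>) \<le> \<beta>"
    using H_le_iff[OF assms(1)] G_le_iff[OF assms(2)] by blast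
  show "\<beta> \<le> H A B (G A B \<beta>)"
  proof (rule ccontr)
    define g where "g = G A B \<beta>"
    assume "\<not> ?thesis"
    then have less: "H A B g < \<beta>" by (simp add: g_def)
    obtain k m "is" where kmi: "k \<in> {1..CARD('n) - 1}" "m \<in> {1..CARD('n) - k}"
      "is \<in> weak_compositions k m" "trace (BA_word A B is) = \<beta> ^ k * g ^ m"
      using G_attained[OF assms] unfolding g_def by blast
    have "g ^ m * H A B g ^ k < g ^ m * \<beta> ^ k"
      using less assms kmi
      by (intro idem_mult_strict_left_mono idem_power_strict_mono) (auto simp: g_def)
    then have "\<not> trace (BA_word A B is) \<le> H A B g ^ k * g ^ m"
      by (simp add: kmi(4) mult.commute not_le)
    then have "\<not> mixed_cycles_bounded A B g (H A B g)"
      using kmi(1-3) unfolding mixed_cycles_bounded_def by blast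
    then show False
      using H_le_iff[of g A B "H A B g"] assms(1) by (simp add: g_def)
  qed
qed

text \<open>
  A common regular subeigenvector bounds the trace of every word at once.  With positive spectral
  radii this also shows that feasible bounds are nonzero, hence invertible.
\<close>

lemma feasible_imp_bounds:
  fixes A B :: "'a::radicable_linordered_idempotent_semifield^'n^'n"
  assumes "feasible A B \<alpha> \<beta>"
  shows "spectral_radius A \<le> \<alpha>" "spectral_radius B \<le> \<beta>" "mixed_cycles_bounded A B \<alpha> \<beta>"
proof -
  obtain x where x: "regular x" "A *v x \<le> \<alpha> *s x" "B *v x \<le> \<beta> *s x"
    using assms by (auto simp: feasible_def conj_form_le_iff)
  show "spectral_radius A \<le> \<alpha>" "spectral_radius B \<le> \<beta>"
    using x by (auto simp: spectral_radius_le_iff intro: trace_le_if_subeigen matrix_pow_subeigen)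
  show "mixed_cycles_bounded A B \<alpha> \<beta>"
    using trace_le_if_subeigen[OF BA_word_subeigen[OF x(2,3)] x(1)]
    by (auto simp: mixed_cycles_bounded_def weak_compositions_def)
qed

lemma Tr_scaled_sum_le_1:
  fixes A B :: "'a::radicable_linordered_idempotent_semifield^'n^'n"
  assumes nz: "\<alpha> \<noteq> 0" "\<beta> \<noteq> 0"
    and A: "spectral_radius A \<le> \<alpha>" and B: "spectral_radius B \<le> \<beta>"
    and AB: "mixed_cycles_bounded A B \<alpha> \<beta>"
  shows "Tr (inverse \<alpha> *k A + inverse \<beta> *k B) \<le> 1"
proof -
  have "trace (matrix_pow (inverse \<alpha> *k A + inverse \<beta> *k B) p) \<le> 1"
    if p: "p \<in> {1..CARD('n)}" for p
  proof (rule trace_sum_power_le)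
    show "trace (matrix_pow (inverse \<alpha> *k A) p) \<le> 1" "trace (matrix_pow (inverse \<beta> *k B) p) \<le> 1"
      using A B p nz
      by (auto simp: matrix_pow_scale trace_matrix_scale inverse_power_mult_le_iff spectral_radius_le_iff)
  next
    fix k m "is"
    assume km: "k \<ge> 1" "m \<ge> 1" "k + m = p" and "is": "is \<in> weak_compositions k m"
    from km p have "k \<in> {1..CARD('n) - 1}" "m \<in> {1..CARD('n) - k}" by auto
    with AB "is" have "trace (BA_word A B is) \<le> \<beta> ^ k * \<alpha> ^ m"
      by (simp add: mixed_cycles_bounded_def)
    then have "inverse \<beta> ^ k * (inverse \<alpha> ^ m * trace (BA_word A B is)) \<le> 1"
      using nz by (simp add: inverse_power_mult_le_iff mult.commute)
    then show "trace (BA_word (inverse \<alpha> *k A) (inverse \<beta> *k B) is) \<le> 1"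
      using "is" by (simp add: BA_word_scale trace_matrix_scale weak_compositions_def mult.assoc)
  qed
  then show ?thesis
    by (simp add: Tr_def sum_le_iff)
qed

lemma scaled_sum_subsolution_iff:
  fixes A B :: "'a::linordered_idempotent_semifield^'n^'n"
  assumes "\<alpha> \<noteq> 0" "\<beta> \<noteq> 0"
  shows "(inverse \<alpha> *k A + inverse \<beta> *k B) *v x \<le> x \<longleftrightarrow> A *v x \<le> \<alpha> *s x \<and> B *v x \<le> \<beta> *s x"
  using assms
  by (auto simp: matrix_vector_le_iff matrix_scale_def distrib_right add_le_iff mult.assoc
      inverse_mult_le_iff)

lemma bounded_solutions_eq_kleene_star_image:
  fixes A B :: "'a::linordered_idempotent_semifield^'n^'n"
  assumes "\<alpha> \<noteq> 0" "\<beta> \<noteq> 0" "Tr (inverse \<alpha> *k A + inverse \<beta> *k B) \<le> 1"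
  shows "{x. regular x \<and> conj_form A x \<le> \<alpha> \<and> conj_form B x \<le> \<beta>} =
    {kleene_star (inverse \<alpha> *k A + inverse \<beta> *k B) *v u | u. regular u}"
  using regular_subsolutions_eq_kleene_star_image[OF assms(3)]
  by (simp add: conj_form_le_iff scaled_sum_subsolution_iff[OF assms(1,2)] cong: conj_cong)

lemma feasible_iff:
  fixes A B :: "'a::radicable_linordered_idempotent_semifield^'n^'n"
  assumes "\<alpha> \<noteq> 0" "\<beta> \<noteq> 0"
  shows "feasible A B \<alpha> \<beta> \<longleftrightarrow>
    spectral_radius A \<le> \<alpha> \<and> spectral_radius B \<le> \<beta> \<and> mixed_cycles_bounded A B \<alpha> \<beta>"
proof
  assume "spectral_radius A \<le> \<alpha> \<and> spectral_radius B \<le> \<beta> \<and> mixed_cycles_bounded A B \<alpha> \<beta>"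
  then have "{x. regular x \<and> conj_form A x \<le> \<alpha> \<and> conj_form B x \<le> \<beta>} =
    {kleene_star (inverse \<alpha> *k A + inverse \<beta> *k B) *v u | u. regular u}"
    using assms by (intro bounded_solutions_eq_kleene_star_image Tr_scaled_sum_le_1) auto
  moreover have "regular (vec 1 :: 'a^'n)"
    by (simp add: regular_def)
  ultimately show "feasible A B \<alpha> \<beta>"
    unfolding feasible_def by blast
qed (auto dest: feasible_imp_bounds)

section \<open>Pareto optimality as minimal feasibility\<close>

definition minimal_feasible ::
    "'a::linordered_idempotent_semifield^'n^'n \<Rightarrow> 'a^'n^'n \<Rightarrow> 'a \<Rightarrow> 'a \<Rightarrow> bool"
  where "minimal_feasible A B \<alpha> \<beta> \<longleftrightarrow> feasible A B \<alpha> \<beta> \<and>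
    (\<forall>\<alpha>' \<beta>'. feasible A B \<alpha>' \<beta>' \<longrightarrow> \<alpha>' \<le> \<alpha> \<longrightarrow> \<beta>' \<le> \<beta> \<longrightarrow> \<alpha>' = \<alpha> \<and> \<beta>' = \<beta>)"

lemma pareto_optimal_iff_minimal_feasible:
  fixes A B :: "'a::linordered_idempotent_semifield^'n^'n"
  shows "pareto_optimal A B x \<longleftrightarrow> regular x \<and> minimal_feasible A B (conj_form A x) (conj_form B x)"
proof
  assume x: "pareto_optimal A B x"
  have "\<alpha>' = conj_form A x \<and> \<beta>' = conj_form B x"
    if feas: "feasible A B \<alpha>' \<beta>'" and le: "\<alpha>' \<le> conj_form A x" "\<beta>' \<le> conj_form B x" for \<alpha>' \<beta>'
  proof -
    obtain y where "regular y" "conj_form A y \<le> \<alpha>'" "conj_form B y \<le> \<beta>'"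
      using feas unfolding feasible_def by blast
    then show ?thesis
      using x le unfolding pareto_optimal_def by (meson leI order.trans order_antisym)
  qed
  with x show "regular x \<and> minimal_feasible A B (conj_form A x) (conj_form B x)"
    unfolding minimal_feasible_def by (auto simp: feasible_def pareto_optimal_def)
next
  assume x: "regular x \<and> minimal_feasible A B (conj_form A x) (conj_form B x)"
  have "conj_form A y = conj_form A x \<and> conj_form B y = conj_form B x"
    if "regular y" "conj_form A y \<le> conj_form A x" "conj_form B y \<le> conj_form B x" for y
    using x that unfolding minimal_feasible_def feasible_def by blast
  with x show "pareto_optimal A B x"
    unfolding pareto_optimal_def by (metis less_irrefl)
qed

lemma bounded_solution_of_minimal:
  assumes "minimal_feasible A B \<alpha> \<beta>"
    and "regular x" "conj_form A x \<le> \<alpha>" "conj_form B x \<le> \<beta>"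
  shows "conj_form A x = \<alpha>" "conj_form B x = \<beta>"
  using assms unfolding minimal_feasible_def feasible_def by blast+

lemma pareto_optimal_at_minimal:
  assumes "minimal_feasible A B \<alpha> \<beta>"
  shows "{x. pareto_optimal A B x \<and> conj_form A x = \<alpha> \<and> conj_form B x = \<beta>} =
    {x. regular x \<and> conj_form A x \<le> \<alpha> \<and> conj_form B x \<le> \<beta>}"
  using assms bounded_solution_of_minimal[OF assms]
  by (auto simp: pareto_optimal_iff_minimal_feasible)

lemma pareto_frontier_eq_minimal_feasible:
  "pareto_frontier A B = {(\<alpha>, \<beta>). minimal_feasible A B \<alpha> \<beta>}"
proof (intro equalityI subsetI)
  fix p
  assume "p \<in> {(\<alpha>, \<beta>). minimal_feasible A B \<alpha> \<beta>}"
  then obtain \<alpha> \<beta> where p: "p = (\<alpha>, \<beta>)" and min: "minimal_feasible A B \<alpha> \<beta>" by auto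
  then obtain x where "x \<in> {x. regular x \<and> conj_form A x \<le> \<alpha> \<and> conj_form B x \<le> \<beta>}"
    unfolding minimal_feasible_def feasible_def by blast
  then show "p \<in> pareto_frontier A B"
    unfolding pareto_frontier_def p pareto_optimal_at_minimal[OF min, symmetric] by auto
qed (auto simp: pareto_frontier_def pareto_optimal_iff_minimal_feasible)

text \<open>
  By minimality a vector within the bounds \<open>\<alpha>\<close> and \<open>\<beta>\<close> attains them, so the optimal vectors at a
  frontier point are the regular subsolutions of \<open>C\<close>.
\<close>

lemma frontier_point_solutions:
  fixes A B :: "'a::radicable_linordered_idempotent_semifield^'n^'n"
  assumes "spectral_radius A > 0" "spectral_radius B > 0" and min: "minimal_feasible A B \<alpha> \<beta>"
  defines "C \<equiv> inverse \<alpha> *k A + inverse \<beta> *k B"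
  shows "Tr C \<le> 1"
    and "{x. pareto_optimal A B x \<and> conj_form A x = \<alpha> \<and> conj_form B x = \<beta>} =
      {kleene_star C *v u | u. regular u}"
proof -
  have feas: "feasible A B \<alpha> \<beta>" using min by (simp add: minimal_feasible_def)
  note bounds = feasible_imp_bounds[OF feas]
  have nz: "\<alpha> \<noteq> 0" "\<beta> \<noteq> 0" using assms(1,2) bounds by auto
  show "Tr C \<le> 1"
    unfolding C_def by (rule Tr_scaled_sum_le_1[OF nz bounds])
  then show "{x. pareto_optimal A B x \<and> conj_form A x = \<alpha> \<and> conj_form B x = \<beta>} =
      {kleene_star C *v u | u. regular u}"
    unfolding C_def pareto_optimal_at_minimal[OF min]
    by (rule bounded_solutions_eq_kleene_star_image[OF nz])
qed

section \<open>The Pareto frontier\<close>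

text \<open>
  Between \<open>\<mu>\<close> and \<open>G \<nu>\<close> the curve \<open>H\<close> stays above \<open>\<nu>\<close>, so there the constraint \<open>\<nu> \<le> \<beta>\<close> is implied and
  strict monotonicity of \<open>H\<close> decides minimality.  Points to the right of \<open>G \<nu>\<close> are dominated by
  \<open>(G \<nu>, \<nu>)\<close>.
\<close>

lemma minimal_feasible_nondegenerate:
  fixes A B :: "'a::radicable_linordered_idempotent_semifield^'n^'n"
  assumes \<mu>: "\<mu> = spectral_radius A" "\<mu> > 0" and \<nu>: "\<nu> = spectral_radius B" "\<nu> > 0"
    and less: "\<mu> < G A B \<nu>"
  shows "minimal_feasible A B \<alpha> \<beta> \<longleftrightarrow> \<mu> \<le> \<alpha> \<and> \<alpha> \<le> G A B \<nu> \<and> \<beta> = H A B \<alpha>"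
proof -
  have nz: "\<nu> \<noteq> 0" "G A B \<nu> \<noteq> 0" using \<nu> less by auto
  have feas: "feasible A B a b \<longleftrightarrow> \<mu> \<le> a \<and> \<nu> \<le> b \<and> H A B a \<le> b" for a b
  proof (cases "a = 0 \<or> b = 0")
    case True
    with \<mu> \<nu> show ?thesis using feasible_imp_bounds(1,2)[of A B a b] by auto
  next
    case False
    with \<mu> \<nu> show ?thesis by (auto simp: feasible_iff H_le_iff)
  qed
  have H_ge: "\<nu> \<le> H A B a" if a: "\<mu> \<le> a" "a \<le> G A B \<nu>" for a
  proof (cases "a = G A B \<nu>")
    case True
    then show ?thesis using H_of_G[OF nz(2,1)] by simp
  next
    case False
    have "a \<noteq> 0" using \<mu> a by auto
    from False a have "a < G A B \<nu>" by simp
    then show ?thesis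
      using H_strict_antimono[of a "G A B \<nu>" A B] H_of_G[OF nz(2,1)] nz \<open>a \<noteq> 0\<close> by simp
  qed
  show ?thesis
  proof
    assume min: "minimal_feasible A B \<alpha> \<beta>"
    then have \<alpha>\<beta>: "\<mu> \<le> \<alpha>" "\<nu> \<le> \<beta>" "H A B \<alpha> \<le> \<beta>"
      by (simp_all add: minimal_feasible_def feas)
    have "\<alpha> \<le> G A B \<nu>"
    proof (rule ccontr)
      assume "\<not> ?thesis"
      moreover have "feasible A B (G A B \<nu>) \<nu>"
        using less H_of_G[OF nz(2,1)] by (simp add: feas)
      ultimately show False
        using min \<alpha>\<beta>(2) unfolding minimal_feasible_def by (metis linear)
    qed
    moreover have "feasible A B \<alpha> (H A B \<alpha>)"
      using \<alpha>\<beta>(1) H_ge[OF \<alpha>\<beta>(1) calculation] by (simp add: feas)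
    ultimately show "\<mu> \<le> \<alpha> \<and> \<alpha> \<le> G A B \<nu> \<and> \<beta> = H A B \<alpha>"
      using min \<alpha>\<beta> unfolding minimal_feasible_def by (metis order_refl)
  next
    assume \<alpha>\<beta>: "\<mu> \<le> \<alpha> \<and> \<alpha> \<le> G A B \<nu> \<and> \<beta> = H A B \<alpha>"
    then have ge: "\<nu> \<le> H A B \<alpha>" using H_ge by blast
    have "a = \<alpha> \<and> b = \<beta>" if "feasible A B a b" "a \<le> \<alpha>" "b \<le> \<beta>" for a b
    proof -
      have ab: "\<mu> \<le> a" "H A B a \<le> b" using that by (simp_all add: feas)
      have "a = \<alpha>"
      proof (rule ccontr)
        assume "a \<noteq> \<alpha>"
        then have "H A B \<alpha> < H A B a"
          using that \<mu> ab ge nz by (intro H_strict_antimono) auto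
        also have "\<dots> \<le> H A B \<alpha>" using ab that \<alpha>\<beta> by auto
        finally show False by simp
      qed
      with ab that \<alpha>\<beta> show ?thesis by auto
    qed
    moreover have "feasible A B \<alpha> \<beta>"
      using \<alpha>\<beta> ge by (simp add: feas)
    ultimately show "minimal_feasible A B \<alpha> \<beta>"
      unfolding minimal_feasible_def by blast
  qed
qed

lemma minimal_feasible_degenerate:
  fixes A B :: "'a::radicable_linordered_idempotent_semifield^'n^'n"
  assumes \<mu>: "\<mu> = spectral_radius A" "\<mu> > 0" and \<nu>: "\<nu> = spectral_radius B" "\<nu> > 0"
    and le: "G A B \<nu> \<le> \<mu>"
  shows "minimal_feasible A B \<alpha> \<beta> \<longleftrightarrow> \<alpha> = \<mu> \<and> \<beta> = \<nu>"
proof -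
  have "feasible A B \<mu> \<nu>"
    using assms by (simp add: feasible_iff flip: G_le_iff)
  moreover have "\<mu> \<le> a \<and> \<nu> \<le> b" if "feasible A B a b" for a b
    using feasible_imp_bounds[OF that] \<mu> \<nu> by simp
  ultimately show ?thesis
    unfolding minimal_feasible_def by (metis order_antisym)
qed

theorem theorem3:
  fixes A B :: "'a::radicable_linordered_idempotent_semifield^'n^'n"
    and \<mu> \<nu> :: 'a
  assumes "\<mu> = spectral_radius A" and "\<nu> = spectral_radius B"
    and "\<mu> > 0" and "\<nu> > 0"
  shows "(\<mu> < G A B \<nu> \<longrightarrow>
      pareto_frontier A B = {(\<alpha>, \<beta>). \<mu> \<le> \<alpha> \<and> \<alpha> \<le> G A B \<nu> \<and> \<beta> = H A B \<alpha>} \<and>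
      (\<forall>(\<alpha>, \<beta>) \<in> pareto_frontier A B.
        Tr (inverse \<alpha> *k A + inverse \<beta> *k B) \<le> 1 \<and>
        {x. pareto_optimal A B x \<and> conj_form A x = \<alpha> \<and> conj_form B x = \<beta>} =
          {kleene_star (inverse \<alpha> *k A + inverse \<beta> *k B) *v u | u. regular u})) \<and>
    (\<mu> \<ge> G A B \<nu> \<longrightarrow>
      pareto_frontier A B = {(\<mu>, \<nu>)} \<and>
      Tr (inverse \<mu> *k A + inverse \<nu> *k B) \<le> 1 \<and>
      {x. pareto_optimal A B x} =
        {kleene_star (inverse \<mu> *k A + inverse \<nu> *k B) *v u | u. regular u})"
proof (intro conjI[of "_ \<longrightarrow> _" "_ \<longrightarrow> _"] impI)
  have pos: "spectral_radius A > 0" "spectral_radius B > 0" using assms by auto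
  note solutions = frontier_point_solutions[OF pos]
  {
    assume "\<mu> < G A B \<nu>"
    then have "pareto_frontier A B = {(\<alpha>, \<beta>). \<mu> \<le> \<alpha> \<and> \<alpha> \<le> G A B \<nu> \<and> \<beta> = H A B \<alpha>}"
      using assms by (simp add: pareto_frontier_eq_minimal_feasible minimal_feasible_nondegenerate)
    moreover have "\<forall>(\<alpha>, \<beta>) \<in> pareto_frontier A B.
        Tr (inverse \<alpha> *k A + inverse \<beta> *k B) \<le> 1 \<and>
        {x. pareto_optimal A B x \<and> conj_form A x = \<alpha> \<and> conj_form B x = \<beta>} =
          {kleene_star (inverse \<alpha> *k A + inverse \<beta> *k B) *v u | u. regular u}"
      using solutions by (force simp: pareto_frontier_eq_minimal_feasible)
    ultimately show "pareto_frontier A B = {(\<alpha>, \<beta>). \<mu> \<le> \<alpha> \<and> \<alpha> \<le> G A B \<nu> \<and> \<beta> = H A B \<alpha>} \<and>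
      (\<forall>(\<alpha>, \<beta>) \<in> pareto_frontier A B.
        Tr (inverse \<alpha> *k A + inverse \<beta> *k B) \<le> 1 \<and>
        {x. pareto_optimal A B x \<and> conj_form A x = \<alpha> \<and> conj_form B x = \<beta>} =
          {kleene_star (inverse \<alpha> *k A + inverse \<beta> *k B) *v u | u. regular u})" by blast
  next
    assume "G A B \<nu> \<le> \<mu>"
    then have min: "minimal_feasible A B \<alpha> \<beta> \<longleftrightarrow> \<alpha> = \<mu> \<and> \<beta> = \<nu>" for \<alpha> \<beta>
      using assms by (intro minimal_feasible_degenerate)
    then have "pareto_frontier A B = {(\<mu>, \<nu>)}"
      by (auto simp: pareto_frontier_eq_minimal_feasible)
    moreover have "{x. pareto_optimal A B x} =
        {x. pareto_optimal A B x \<and> conj_form A x = \<mu> \<and> conj_form B x = \<nu>}"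
      using min by (auto simp: pareto_optimal_iff_minimal_feasible)
    ultimately show "pareto_frontier A B = {(\<mu>, \<nu>)} \<and>
      Tr (inverse \<mu> *k A + inverse \<nu> *k B) \<le> 1 \<and>
      {x. pareto_optimal A B x} =
        {kleene_star (inverse \<mu> *k A + inverse \<nu> *k B) *v u | u. regular u}"
      using solutions[of \<mu> \<nu>] min by simp
  }
qed

end
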